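(* Let $(A,\mu,\alpha,\beta)$ be a regular BiHom-algebra over a field $\mathbb{K}$ of characteristic $0$. If $(A,\mu,\alpha,\beta)$ is left BiHom-alternative and BiHom-flexible, then it is BiHom-alternative.
   Context: All vector spaces are over a field $\mathbb{K}$ of characteristic $0$. A BiHom-algebra is a quadruple $(A,\mu,\alpha,\beta)$ where $A$ is a vector space, $\mu:A\otimes A\to A$, $\alpha,\beta:A\to A$ are linear maps, and $\alpha\beta=\beta\alpha$. It is regular if $\alpha$ and $\beta$ are bijective. The BiHom-associator is the trilinear map $as_{\alpha,\beta}(x,y,z)=\mu(\mu(x,y),\beta(z))-\mu(\alpha(x),\mu(y,z))$. The BiHom-algebra is: - left BiHom-alternative if $as_{\alpha,\beta}(\beta(x),\alpha(y),z)+as_{\alpha,\beta}(\beta(y),\alpha(x),z)=0$ for all $x,y,z\in A$; - right BiHom-alternative if $as_{\alpha,\beta}(x,\beta(y),\alpha(z))+as_{\alpha,\beta}(x,\beta(z),\alpha(y))=0$ for all $x,y,z\in A$; - BiHom-alternative if it is both left and right BiHom-alternative; - BiHom-flexible if $as_{\alpha,\beta}(\beta^{2}(x),\alpha\beta(y),\alpha^{2}(z))+as_{\alpha,\beta}(\beta^{2}(z),\alpha\beta(y),\alpha^{2}(x))=0$ for all $x,y,z\in A$. *)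

theory Defs
  imports Complex_Main
begin

text \<open>
  A linear map from the tensor square of A to A is given as a bilinear map
  \<open>\<mu>\<close> in curried form. The structure maps
  \<open>\<alpha>\<close> and \<open>\<beta>\<close> are not required to be multiplicative
  with respect to \<open>\<mu>\<close>.
\<close>

locale bihom_algebra = vector_space scale
  for scale :: "'k::field_char_0 \<Rightarrow> 'a::ab_group_add \<Rightarrow> 'a" +
  fixes \<mu> :: "'a \<Rightarrow> 'a \<Rightarrow> 'a"
    and \<alpha> \<beta> :: "'a \<Rightarrow> 'a"
  assumes linear_mult_left: "\<And>y. Vector_Spaces.linear scale scale (\<lambda>x. \<mu> x y)"
    and linear_mult_right: "\<And>x. Vector_Spaces.linear scale scale (\<lambda>y. \<mu> x y)"
    and linear_\<alpha>: "Vector_Spaces.linear scale scale \<alpha>"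
    and linear_\<beta>: "Vector_Spaces.linear scale scale \<beta>"
    and commute: "\<alpha> \<circ> \<beta> = \<beta> \<circ> \<alpha>"

locale regular_bihom_algebra = bihom_algebra +
  assumes bij_\<alpha>: "bij \<alpha>"
    and bij_\<beta>: "bij \<beta>"

definition bihom_associator ::
  "('a::ab_group_add \<Rightarrow> 'a \<Rightarrow> 'a) \<Rightarrow> ('a \<Rightarrow> 'a) \<Rightarrow> ('a \<Rightarrow> 'a) \<Rightarrow> 'a \<Rightarrow> 'a \<Rightarrow> 'a \<Rightarrow> 'a" where
  "bihom_associator \<mu> \<alpha> \<beta> x y z = \<mu> (\<mu> x y) (\<beta> z) - \<mu> (\<alpha> x) (\<mu> y z)"

definition left_bihom_alternative ::
  "('a::ab_group_add \<Rightarrow> 'a \<Rightarrow> 'a) \<Rightarrow> ('a \<Rightarrow> 'a) \<Rightarrow> ('a \<Rightarrow> 'a) \<Rightarrow> bool" where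
  "left_bihom_alternative \<mu> \<alpha> \<beta> \<longleftrightarrow>
    (\<forall>x y z. bihom_associator \<mu> \<alpha> \<beta> (\<beta> x) (\<alpha> y) z
           + bihom_associator \<mu> \<alpha> \<beta> (\<beta> y) (\<alpha> x) z = 0)"

definition right_bihom_alternative ::
  "('a::ab_group_add \<Rightarrow> 'a \<Rightarrow> 'a) \<Rightarrow> ('a \<Rightarrow> 'a) \<Rightarrow> ('a \<Rightarrow> 'a) \<Rightarrow> bool" where
  "right_bihom_alternative \<mu> \<alpha> \<beta> \<longleftrightarrow>
    (\<forall>x y z. bihom_associator \<mu> \<alpha> \<beta> x (\<beta> y) (\<alpha> z)
           + bihom_associator \<mu> \<alpha> \<beta> x (\<beta> z) (\<alpha> y) = 0)"

definition bihom_alternative ::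
  "('a::ab_group_add \<Rightarrow> 'a \<Rightarrow> 'a) \<Rightarrow> ('a \<Rightarrow> 'a) \<Rightarrow> ('a \<Rightarrow> 'a) \<Rightarrow> bool" where
  "bihom_alternative \<mu> \<alpha> \<beta> \<longleftrightarrow>
    left_bihom_alternative \<mu> \<alpha> \<beta> \<and> right_bihom_alternative \<mu> \<alpha> \<beta>"

definition bihom_flexible ::
  "('a::ab_group_add \<Rightarrow> 'a \<Rightarrow> 'a) \<Rightarrow> ('a \<Rightarrow> 'a) \<Rightarrow> ('a \<Rightarrow> 'a) \<Rightarrow> bool" where
  "bihom_flexible \<mu> \<alpha> \<beta> \<longleftrightarrow>
    (\<forall>x y z. bihom_associator \<mu> \<alpha> \<beta> (\<beta> (\<beta> x)) (\<alpha> (\<beta> y)) (\<alpha> (\<alpha> z))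
           + bihom_associator \<mu> \<alpha> \<beta> (\<beta> (\<beta> z)) (\<alpha> (\<beta> y)) (\<alpha> (\<alpha> x)) = 0)"

end

theory Submission
  imports Defs
begin

text \<open>
  Put \<open>F x y z = as(\<beta>\<^sup>2 x, \<alpha>\<beta> y, \<alpha>\<^sup>2 z)\<close>, where \<open>as\<close> is the BiHom-associator.
  Up to substitutions in the arguments, each of the three BiHom-identities says that \<open>F\<close> changes
  sign under a transposition of its arguments: left alternativity gives the transposition
  \<open>(1 2)\<close>, flexibility gives \<open>(1 3)\<close>, and right alternativity is the claim for \<open>(2 3)\<close>.
  Since \<open>(2 3) = (1 3) (1 2) (1 3)\<close> in the symmetric group, the first two imply the third
  for \<open>F\<close>. Because \<open>\<alpha>\<close> and \<open>\<beta>\<close> are surjective, every instance of right alternativity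
  is an instance of this skew-symmetry of \<open>F\<close>.
\<close>

lemma skew_12_13_imp_skew_23:
  fixes F :: "'b \<Rightarrow> 'b \<Rightarrow> 'b \<Rightarrow> 'a::group_add"
  assumes skew_12: "\<And>x y z. F x y z = - F y x z"
    and skew_13: "\<And>x y z. F x y z = - F z y x"
  shows "F x y z = - F x z y"
proof -
  have "F x y z = - F z y x"
    by (rule skew_13)
  also have "\<dots> = F y z x"
    using skew_12[of y z x] by simp
  also have "\<dots> = - F x z y"
    by (rule skew_13)
  finally show ?thesis .
qed

theorem proposition2p5:
  fixes scale :: "'k::field_char_0 \<Rightarrow> 'a::ab_group_add \<Rightarrow> 'a"
    and \<mu> :: "'a \<Rightarrow> 'a \<Rightarrow> 'a"
    and \<alpha> \<beta> :: "'a \<Rightarrow> 'a"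
  assumes "regular_bihom_algebra scale \<mu> \<alpha> \<beta>"
    and "left_bihom_alternative \<mu> \<alpha> \<beta>"
    and "bihom_flexible \<mu> \<alpha> \<beta>"
  shows "bihom_alternative \<mu> \<alpha> \<beta>"
proof -
  interpret regular_bihom_algebra scale \<mu> \<alpha> \<beta> by (fact assms(1))
  have comm: "\<beta> (\<alpha> x) = \<alpha> (\<beta> x)" for x
    using fun_cong[OF commute, of x] by simp
  define F where
    "F x y z = bihom_associator \<mu> \<alpha> \<beta> (\<beta> (\<beta> x)) (\<alpha> (\<beta> y)) (\<alpha> (\<alpha> z))" for x y z
  have skew_12: "F x y z = - F y x z" for x y z
  proof -
    \<comment> \<open>Left alternativity at \<open>\<beta> x\<close>, \<open>\<beta> y\<close>, \<open>\<alpha>\<^sup>2 z\<close>.\<close>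
    have "F x y z + F y x z = 0"
      using assms(2) unfolding left_bihom_alternative_def F_def by blast
    then show ?thesis by (rule eq_neg_iff_add_eq_0[THEN iffD2])
  qed
  have skew_13: "F x y z = - F z y x" for x y z
    using assms(3) unfolding bihom_flexible_def F_def by (simp add: eq_neg_iff_add_eq_0)
  have "right_bihom_alternative \<mu> \<alpha> \<beta>"
    unfolding right_bihom_alternative_def
  proof (intro allI)
    fix x y z
    obtain x' where x: "x = \<beta> (\<beta> x')"
      using bij_\<beta> by (metis bij_pointE)
    obtain y' z' where y: "y = \<alpha> y'" and z: "z = \<alpha> z'"
      using bij_\<alpha> by (metis bij_pointE)
    have "F x' y' z' + F x' z' y' = 0"
      using skew_12_13_imp_skew_23[of F, OF skew_12 skew_13]
      by (simp add: eq_neg_iff_add_eq_0)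
    then show "bihom_associator \<mu> \<alpha> \<beta> x (\<beta> y) (\<alpha> z)
        + bihom_associator \<mu> \<alpha> \<beta> x (\<beta> z) (\<alpha> y) = 0"
      unfolding F_def x y z comm .
  qed
  with assms(2) show ?thesis
    unfolding bihom_alternative_def by blast
qed

end
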